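(* Let $(V,V^+)$ be an ordered real vector space with an order unit $e$, and let $V_{\mathrm{Arch}}$ be the Archimedeanization of $V$. Then there exists a unital surjective positive linear map $q : V \to V_{\mathrm{Arch}}$ with the following property: whenever $(W,W^+)$ is an ordered real vector space with Archimedean order unit $e'$ and $\phi : V \to W$ is a unital positive linear map, there exists a unique positive linear map $\widetilde{\phi} : V_{\mathrm{Arch}} \to W$ with $\phi = \widetilde{\phi} \circ q$. In addition, this property characterizes $V_{\mathrm{Arch}}$: if $V'$ is any ordered real vector space with an Archimedean order unit and $q' : V \to V'$ is a unital surjective positive linear map such that for every ordered real vector space $(W,W^+)$ with Archimedean order unit and every unital positive linear map $\phi:V\to W$ there is a unique positive linear map $\phi':V'\to W$ with $\phi=\phi'\circ q'$, then $V'$ is isomorphic to $V_{\mathrm{Arch}}$ via a unital order isomorphism $\psi : V_{\mathrm{Arch}} \to V'$ with $\psi \circ q = q'$.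
   Context: An ordered real vector space $(V,V^+)$ is a real vector space $V$ with a nonempty subset $V^+\subseteq V$ closed under addition and under multiplication by scalars in $[0,\infty)$, such that $V^+\cap -V^+=\{0\}$. One writes $v\ge w$ if $v-w\in V^+$. An element $e\in V$ is an order unit if for each $v\in V$ there is a real $r>0$ with $re\ge v$; it is an Archimedean order unit if, in addition, whenever $v\in V$ satisfies $re+v\ge 0$ for all real $r>0$, then $v\in V^+$. A linear map $\phi:V\to W$ between ordered real vector spaces with order units $e$, $e'$ is positive if $\phi(V^+)\subseteq W^+$ and unital if $\phi(e)=e'$. It is an order isomorphism if it is a bijection and, for all $v\in V$, $v\in V^+$ if and only if $\phi(v)\in W^+$. Archimedeanization: for $(V,V^+)$ with order unit $e$, let $D := \{ v \in V : re + v \in V^+ \text{ for all real } r >0 \}$ and $N := D \cap -D$ (a subspace). Then $V_{\mathrm{Arch}}$ is the quotient space $V/N$ with positive cone $(V/N)^+:=\{v+N: v\in D\}$ and order unit $e+N$; this is an ordered real vector space with Archimedean order unit $e+N$. *)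

theory Defs
  imports "HOL-Algebra.Module" "HOL-Algebra.AbelCoset" "HOL.Real"
begin

text \<open>
  Vector spaces are carrier-based modules of HOL-Algebra over the ring of real numbers, because
  one has to quantify over all ordered vector spaces inside a formula and to form the quotient
  of a space by a subspace that depends on its cone. The fields \<open>mult\<close> and \<open>one\<close> that
  module records inherit from rings carry no information here.
\<close>

definition real_ring :: "real ring" where
  "real_ring = \<lparr>carrier = UNIV, mult = (*), one = 1, zero = 0, add = (+)\<rparr>"

record 'v ordered_module = "(real, 'v) module" +
  pos_cone :: "'v set"

locale ordered_vector_space = module real_ring V
  for V :: "'v ordered_module" (structure) +
  assumes cone_subset: "pos_cone V \<subseteq> carrier V"
    and cone_nonempty: "pos_cone V \<noteq> {}"
    and cone_add: "x \<in> pos_cone V \<Longrightarrow> y \<in> pos_cone V \<Longrightarrow> x \<oplus> y \<in> pos_cone V"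
    and cone_smult: "(r::real) \<ge> 0 \<Longrightarrow> x \<in> pos_cone V \<Longrightarrow> r \<odot> x \<in> pos_cone V"
    and cone_proper: "pos_cone V \<inter> (\<lambda>x. \<ominus> x) ` pos_cone V = {\<zero>}"

definition vec_ge :: "'v ordered_module \<Rightarrow> 'v \<Rightarrow> 'v \<Rightarrow> bool" where
  "vec_ge V v w \<longleftrightarrow> v \<ominus>\<^bsub>V\<^esub> w \<in> pos_cone V"

definition order_unit :: "'v ordered_module \<Rightarrow> 'v \<Rightarrow> bool" where
  "order_unit V e \<longleftrightarrow>
     e \<in> carrier V \<and> (\<forall>v\<in>carrier V. \<exists>r::real>0. vec_ge V (r \<odot>\<^bsub>V\<^esub> e) v)"

definition archimedean_order_unit :: "'v ordered_module \<Rightarrow> 'v \<Rightarrow> bool" where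
  "archimedean_order_unit V e \<longleftrightarrow>
     order_unit V e \<and>
     (\<forall>v\<in>carrier V. (\<forall>r::real>0. vec_ge V (r \<odot>\<^bsub>V\<^esub> e \<oplus>\<^bsub>V\<^esub> v) \<zero>\<^bsub>V\<^esub>) \<longrightarrow> v \<in> pos_cone V)"

text \<open>
  A map between spaces is a function on the carrier, represented by its extension with the value
  \<open>undefined\<close> outside the carrier, so that equality of maps is equality in HOL, and composition
  is \<^const>\<open>compose\<close>.
\<close>

definition linear_maps :: "'v ordered_module \<Rightarrow> 'w ordered_module \<Rightarrow> ('v \<Rightarrow> 'w) set" where
  "linear_maps V W =
     {f \<in> carrier V \<rightarrow>\<^sub>E carrier W.
        (\<forall>x\<in>carrier V. \<forall>y\<in>carrier V. f (x \<oplus>\<^bsub>V\<^esub> y) = f x \<oplus>\<^bsub>W\<^esub> f y) \<and>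
        (\<forall>r::real. \<forall>x\<in>carrier V. f (r \<odot>\<^bsub>V\<^esub> x) = r \<odot>\<^bsub>W\<^esub> f x)}"

definition positive_linear_maps :: "'v ordered_module \<Rightarrow> 'w ordered_module \<Rightarrow> ('v \<Rightarrow> 'w) set" where
  "positive_linear_maps V W = {f \<in> linear_maps V W. f ` pos_cone V \<subseteq> pos_cone W}"

definition order_isomorphisms :: "'v ordered_module \<Rightarrow> 'w ordered_module \<Rightarrow> ('v \<Rightarrow> 'w) set" where
  "order_isomorphisms V W =
     {f \<in> linear_maps V W. bij_betw f (carrier V) (carrier W) \<and>
        (\<forall>v\<in>carrier V. v \<in> pos_cone V \<longleftrightarrow> f v \<in> pos_cone W)}"

definition arch_D :: "'v ordered_module \<Rightarrow> 'v \<Rightarrow> 'v set" where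
  "arch_D V e = {v \<in> carrier V. \<forall>r::real>0. r \<odot>\<^bsub>V\<^esub> e \<oplus>\<^bsub>V\<^esub> v \<in> pos_cone V}"

definition arch_N :: "'v ordered_module \<Rightarrow> 'v \<Rightarrow> 'v set" where
  "arch_N V e = arch_D V e \<inter> (\<lambda>v. \<ominus>\<^bsub>V\<^esub> v) ` arch_D V e"

text \<open>
  The scalar multiple of a coset is the union of the cosets of the multiples of its elements, in
  analogy with \<open>rcoset_mult\<close>; the plain image would be wrong for the scalar zero.
\<close>

definition archimedeanization :: "'v ordered_module \<Rightarrow> 'v \<Rightarrow> 'v set ordered_module" where
  "archimedeanization V e =
     \<lparr>carrier = a_rcosets\<^bsub>V\<^esub> (arch_N V e), mult = undefined, one = undefined,
      zero = arch_N V e, add = set_add V,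
      smult = (\<lambda>r X. \<Union>x\<in>X. arch_N V e +>\<^bsub>V\<^esub> (r \<odot>\<^bsub>V\<^esub> x)),
      pos_cone = (\<lambda>v. arch_N V e +>\<^bsub>V\<^esub> v) ` arch_D V e\<rparr>"

definition arch_unit :: "'v ordered_module \<Rightarrow> 'v \<Rightarrow> 'v set" where
  "arch_unit V e = arch_N V e +>\<^bsub>V\<^esub> e"

definition arch_quotient_map :: "'v ordered_module \<Rightarrow> 'v \<Rightarrow> 'v \<Rightarrow> 'v set" where
  "arch_quotient_map V e = (\<lambda>v\<in>carrier V. arch_N V e +>\<^bsub>V\<^esub> v)"

text \<open>
  The universal property of a map \<open>q\<close> from \<open>V\<close> (with order unit \<open>e\<close>) to \<open>A\<close>, tested against all
  target spaces whose elements are taken from the type \<open>'w\<close>. HOL cannot quantify over types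
  inside a formula. Where the property is asserted of \<open>V_Arch\<close>, \<open>'w\<close> is left arbitrary and \<open>q\<close> is
  identified as \<^const>\<open>arch_quotient_map\<close>, so that one map \<open>q\<close> serves all types. Where it is
  assumed of some \<open>V'\<close>, it is assumed only for \<open>'w\<close> the type of the elements of \<open>V_Arch\<close>, which
  is weaker than assuming it for all types.
\<close>

definition arch_universal ::
  "'w itself \<Rightarrow> 'v ordered_module \<Rightarrow> 'v \<Rightarrow> 'a ordered_module \<Rightarrow> ('v \<Rightarrow> 'a) \<Rightarrow> bool" where
  "arch_universal (_ :: 'w itself) V e A q \<longleftrightarrow>
     (\<forall>(W :: 'w ordered_module) e' \<phi>.
        ordered_vector_space W \<and> archimedean_order_unit W e' \<and>
        \<phi> \<in> positive_linear_maps V W \<and> \<phi> e = e' \<longrightarrow>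
        (\<exists>!\<phi>'. \<phi>' \<in> positive_linear_maps A W \<and> \<phi> = compose (carrier V) \<phi>' q))"

end

theory Submission
  imports Defs
begin

text \<open>
  The quotient map \<open>q\<close> sends \<open>v\<close> to its coset modulo \<open>N = D \<inter> -D\<close>. Since \<open>N\<close> is a subspace and
  \<open>D + N \<subseteq> D\<close>, the coset of \<open>v\<close> is positive in the Archimedeanization exactly when \<open>v \<in> D\<close>
  (\<open>quotient_map_in_cone_iff\<close>). Hence \<open>V_Arch\<close> is an ordered space, and it is Archimedean because
  \<open>D\<close> is closed under the Archimedean condition: if \<open>r e + v \<in> D\<close> for all \<open>r > 0\<close>, then
  \<open>r e + v = r/2 e + (r/2 e + v)\<close> is positive for all \<open>r > 0\<close>.

  A unital positive map \<open>\<phi>\<close> into a space with Archimedean order unit maps \<open>D\<close> into the cone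
  (\<open>unital_positive_map_arch_D\<close>) and therefore \<open>N\<close> to \<open>0\<close>, so it factors through \<open>q\<close>; the factor
  is positive, and it is unique because \<open>q\<close> is surjective.

  If \<open>q' : V \<rightarrow> V'\<close> has the same universal property, the two factorizations of \<open>q'\<close> through \<open>q\<close>
  and of \<open>q\<close> through \<open>q'\<close> are positive and, by surjectivity of \<open>q\<close> and \<open>q'\<close>, inverse to each other.
\<close>

section \<open>Elementary facts on ordered vector spaces\<close>

context ordered_vector_space
begin

lemma real_smult_closed [simp, intro]: "x \<in> carrier V \<Longrightarrow> (r::real) \<odot> x \<in> carrier V"
  using smult_closed[of r x] by (simp add: real_ring_def)

lemma smult_add_left: "x \<in> carrier V \<Longrightarrow> (r + s :: real) \<odot> x = r \<odot> x \<oplus> s \<odot> x"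
  using smult_l_distr[of r s x] by (simp add: real_ring_def)

lemma smult_add_right:
  "x \<in> carrier V \<Longrightarrow> y \<in> carrier V \<Longrightarrow> (r::real) \<odot> (x \<oplus> y) = r \<odot> x \<oplus> r \<odot> y"
  using smult_r_distr[of r x y] by (simp add: real_ring_def)

lemma smult_mult: "x \<in> carrier V \<Longrightarrow> (r * s :: real) \<odot> x = r \<odot> (s \<odot> x)"
  using smult_assoc1[of r s x] by (simp add: real_ring_def)

lemma smult_1 [simp]: "x \<in> carrier V \<Longrightarrow> (1::real) \<odot> x = x"
  using smult_one[of x] by (simp add: real_ring_def)

lemma smult_0 [simp]: "x \<in> carrier V \<Longrightarrow> (0::real) \<odot> x = \<zero>"
  using smult_l_null[of x] by (simp add: real_ring_def)

lemma smult_minus_right: "x \<in> carrier V \<Longrightarrow> (r::real) \<odot> (\<ominus> x) = \<ominus> (r \<odot> x)"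
  using smult_r_minus[of r x] by (simp add: real_ring_def)

lemma smult_minus_left:
  assumes "x \<in> carrier V"
  shows "(- r :: real) \<odot> x = \<ominus> (r \<odot> x)"
proof -
  have "(- r) \<odot> x \<oplus> r \<odot> x = \<zero>"
    using smult_add_left[of x "- r" r] assms by simp
  then show ?thesis
    using assms by (metis M.minus_equality real_smult_closed)
qed

lemma minus_zero [simp]: "\<ominus> \<zero> = \<zero>"
  by (rule M.minus_equality) simp_all

lemma diff_zero [simp]: "x \<in> carrier V \<Longrightarrow> x \<ominus> \<zero> = x"
  by (simp add: a_minus_def)

lemma cone_carrier: "x \<in> pos_cone V \<Longrightarrow> x \<in> carrier V"
  using cone_subset by blast

lemma zero_in_cone: "\<zero> \<in> pos_cone V"
  using cone_proper by blast

lemma cone_antisym: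
  assumes "x \<in> pos_cone V" "\<ominus> x \<in> pos_cone V"
  shows "x = \<zero>"
proof -
  have "x = \<ominus> (\<ominus> x)"
    using cone_carrier[OF assms(1)] by simp
  then show ?thesis
    using assms cone_proper by blast
qed

lemma order_unit_in_cone:
  assumes "order_unit V e"
  shows "e \<in> pos_cone V"
proof -
  have e: "e \<in> carrier V"
    using assms by (simp add: order_unit_def)
  obtain r :: real where r: "r > 0" "vec_ge V (r \<odot> e) \<zero>"
    using assms by (auto simp: order_unit_def)
  then have "r \<odot> e \<in> pos_cone V"
    using e by (simp add: vec_ge_def)
  then have "inverse r \<odot> (r \<odot> e) \<in> pos_cone V"
    using r(1) by (auto intro: cone_smult[of "inverse r" "r \<odot> e"])
  then show ?thesis
    using r(1) e by (simp flip: smult_mult)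
qed

end

lemma linear_maps_minus:
  assumes "ordered_vector_space V" "ordered_vector_space W" "f \<in> linear_maps V W"
    and "x \<in> carrier V"
  shows "f (\<ominus>\<^bsub>V\<^esub> x) = \<ominus>\<^bsub>W\<^esub> f x"
proof -
  interpret V: ordered_vector_space V by fact
  interpret W: ordered_vector_space W by fact
  have "f x \<in> carrier W"
    using assms(3,4) by (auto simp: linear_maps_def)
  moreover have "f ((-1::real) \<odot>\<^bsub>V\<^esub> x) = (-1::real) \<odot>\<^bsub>W\<^esub> f x"
    using assms(3,4) unfolding linear_maps_def by blast
  ultimately show ?thesis
    using assms(4) by (simp add: V.smult_minus_left W.smult_minus_left)
qed

section \<open>The Archimedeanization as an ordered vector space\<close>

text \<open>
  An ordered vector space with a chosen order unit \<open>e\<close>, not necessarily Archimedean. In the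
  locale, \<open>A\<close> is its Archimedeanization and \<open>q\<close> the quotient map. Elements of \<open>A\<close> are always
  written as \<open>q v\<close>, and its operations and cone are computed on representatives.
\<close>

locale order_unit_space = ordered_vector_space +
  fixes e
  assumes order_unit: "order_unit V e"
begin

abbreviation "D \<equiv> arch_D V e"
abbreviation "N \<equiv> arch_N V e"
abbreviation "A \<equiv> archimedeanization V e"
abbreviation "q \<equiv> arch_quotient_map V e"

lemma unit_carrier [simp]: "e \<in> carrier V"
  using order_unit by (simp add: order_unit_def)

lemma arch_D_carrier: "v \<in> D \<Longrightarrow> v \<in> carrier V"
  by (simp add: arch_D_def)

lemma cone_subset_arch_D: "pos_cone V \<subseteq> D"
  by (auto simp: arch_D_def cone_carrier intro!: cone_add cone_smult order_unit_in_cone[OF order_unit])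

lemma arch_D_add:
  assumes v: "v \<in> D" and w: "w \<in> D"
  shows "v \<oplus> w \<in> D"
proof -
  have carr: "v \<in> carrier V" "w \<in> carrier V"
    using v w by (simp_all add: arch_D_carrier)
  have "r \<odot> e \<oplus> (v \<oplus> w) \<in> pos_cone V" if "r > 0" for r :: real
  proof -
    have "(r/2) \<odot> e \<oplus> v \<in> pos_cone V" "(r/2) \<odot> e \<oplus> w \<in> pos_cone V"
      using v w that by (simp_all add: arch_D_def)
    then have "((r/2) \<odot> e \<oplus> v) \<oplus> ((r/2) \<odot> e \<oplus> w) \<in> pos_cone V"
      by (rule cone_add)
    moreover have "r \<odot> e = (r/2) \<odot> e \<oplus> (r/2) \<odot> e"
      using smult_add_left[of e "r/2" "r/2"] by simp
    ultimately show ?thesis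
      using carr by (simp add: M.add.m_ac)
  qed
  then show ?thesis
    using carr by (simp add: arch_D_def)
qed

lemma arch_D_smult:
  assumes v: "v \<in> D" and "r \<ge> (0::real)"
  shows "r \<odot> v \<in> D"
proof (cases "r = 0")
  case True
  then show ?thesis
    using v cone_subset_arch_D zero_in_cone by (auto simp: arch_D_carrier)
next
  case False
  with assms(2) have r: "r > 0" by simp
  have carr: "v \<in> carrier V"
    using v by (rule arch_D_carrier)
  have "s \<odot> e \<oplus> r \<odot> v \<in> pos_cone V" if "s > 0" for s :: real
  proof -
    have "(s / r) \<odot> e \<oplus> v \<in> pos_cone V"
      using v r that by (simp add: arch_D_def)
    then have "r \<odot> ((s / r) \<odot> e \<oplus> v) \<in> pos_cone V"
      using r by (intro cone_smult) auto
    then show ?thesis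
      using r carr by (simp add: smult_add_right flip: smult_mult)
  qed
  then show ?thesis
    using carr by (simp add: arch_D_def)
qed

text \<open>Applying the construction of \<open>D\<close> to \<open>D\<close> itself adds nothing new.\<close>

lemma arch_D_archimedean:
  assumes v: "v \<in> carrier V" and D: "\<And>r::real. r > 0 \<Longrightarrow> r \<odot> e \<oplus> v \<in> D"
  shows "v \<in> D"
proof -
  have "r \<odot> e \<oplus> v \<in> pos_cone V" if "r > 0" for r :: real
  proof -
    have "(r/2) \<odot> e \<oplus> ((r/2) \<odot> e \<oplus> v) \<in> pos_cone V"
      using D[of "r/2"] that by (simp add: arch_D_def)
    moreover have "r \<odot> e = (r/2) \<odot> e \<oplus> (r/2) \<odot> e"
      using smult_add_left[of e "r/2" "r/2"] by simp
    ultimately show ?thesis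
      using v by (simp add: M.add.m_ac)
  qed
  then show ?thesis
    using v by (simp add: arch_D_def)
qed

lemma arch_N_iff: "v \<in> N \<longleftrightarrow> v \<in> D \<and> \<ominus> v \<in> D"
proof
  assume "v \<in> N"
  then show "v \<in> D \<and> \<ominus> v \<in> D"
    by (auto simp: arch_N_def arch_D_carrier)
next
  assume v: "v \<in> D \<and> \<ominus> v \<in> D"
  then have "v = \<ominus> (\<ominus> v)"
    by (simp add: arch_D_carrier)
  with v show "v \<in> N"
    unfolding arch_N_def by blast
qed

lemma arch_N_carrier: "v \<in> N \<Longrightarrow> v \<in> carrier V"
  by (simp add: arch_N_iff arch_D_carrier)

lemma arch_N_smult:
  assumes v: "v \<in> N"
  shows "(r::real) \<odot> v \<in> N"
proof (cases "r \<ge> 0")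
  case True
  then show ?thesis
    using v arch_D_smult[of v r] arch_D_smult[of "\<ominus> v" r]
    by (simp add: arch_N_iff arch_D_carrier smult_minus_right)
next
  case False
  have "v \<in> carrier V"
    using v by (rule arch_N_carrier)
  then show ?thesis
    using v False arch_D_smult[of v "- r"] arch_D_smult[of "\<ominus> v" "- r"]
    by (simp add: arch_N_iff smult_minus_right smult_minus_left)
qed

lemma arch_N_submodule: "submodule N real_ring V"
proof (rule submoduleI)
  show "\<zero> \<in> N"
    using zero_in_cone cone_subset_arch_D by (auto simp: arch_N_iff)
  show "a \<oplus> b \<in> N" if "a \<in> N" "b \<in> N" for a b
    using that by (simp add: arch_N_iff arch_D_carrier arch_D_add M.minus_add)
qed (auto simp: arch_N_smult arch_N_carrier, simp add: arch_N_iff arch_D_carrier)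

lemma arch_N_abelian_subgroup: "abelian_subgroup N V"
  using arch_N_submodule
  by (intro abelian_subgroupI3 additive_subgroupI M.abelian_group_axioms) (simp add: submodule_def)

lemmas arch_N_subgroup = submodule.axioms(1)[OF arch_N_submodule]

lemma quotient_map_eq_iff:
  assumes "x \<in> carrier V" "y \<in> carrier V"
  shows "q x = q y \<longleftrightarrow> x \<ominus> y \<in> N"
proof -
  have N: "N \<subseteq> carrier V"
    using arch_N_carrier by blast
  have "N +> x = N +> y \<longleftrightarrow> N +> (x \<ominus> y) = N"
    using assms N M.a_coset_add_inv1[of N x y] M.a_coset_add_inv2[of N x y]
    by (auto simp: a_minus_def)
  also have "\<dots> \<longleftrightarrow> x \<ominus> y \<in> N"
    using assms M.a_coset_join1[OF _ _ arch_N_subgroup] M.a_coset_join2[OF _ arch_N_subgroup]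
    by auto
  finally show ?thesis
    using assms by (simp add: arch_quotient_map_def)
qed

lemma arch_carrier: "carrier A = q ` carrier V"
  by (auto simp: archimedeanization_def arch_quotient_map_def A_RCOSETS_def')

lemma arch_cone: "pos_cone A = q ` D"
  by (auto simp: archimedeanization_def arch_quotient_map_def arch_D_carrier)

lemma quotient_map_carrier [simp]: "x \<in> carrier V \<Longrightarrow> q x \<in> carrier A"
  by (simp add: arch_carrier)

lemma arch_zero: "\<zero>\<^bsub>A\<^esub> = q \<zero>"
proof -
  have "N \<subseteq> carrier V"
    using arch_N_carrier by blast
  then show ?thesis
    by (simp add: archimedeanization_def arch_quotient_map_def)
qed

lemma arch_add:
  assumes "x \<in> carrier V" "y \<in> carrier V"
  shows "q x \<oplus>\<^bsub>A\<^esub> q y = q (x \<oplus> y)"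
  using assms abelian_subgroup.a_rcos_sum[OF arch_N_abelian_subgroup]
  by (simp add: archimedeanization_def arch_quotient_map_def)

lemma arch_smult:
  assumes x: "x \<in> carrier V"
  shows "(r::real) \<odot>\<^bsub>A\<^esub> q x = q (r \<odot> x)"
proof -
  \<comment> \<open>All cosets in the union that defines scalar multiplication coincide.\<close>
  have coset: "N +> r \<odot> y = N +> r \<odot> x" if y: "y \<in> N +> x" for y
  proof -
    obtain n where n: "n \<in> N" "y = n \<oplus> x"
      using y by (auto simp: a_r_coset_def')
    have "n \<in> carrier V"
      using n by (simp add: arch_N_carrier)
    then have "r \<odot> y \<ominus> r \<odot> x = r \<odot> n" and "y \<in> carrier V"
      using n x by (simp_all add: smult_add_right a_minus_def M.a_assoc M.r_neg)
    then have "q (r \<odot> y) = q (r \<odot> x)"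
      using n x by (simp add: quotient_map_eq_iff arch_N_smult)
    then show ?thesis
      using x \<open>y \<in> carrier V\<close> by (simp add: arch_quotient_map_def)
  qed
  have "x \<in> N +> x"
    using abelian_subgroup.a_rcos_self[OF arch_N_abelian_subgroup x] .
  with coset have "(\<Union>y\<in>N +> x. N +> r \<odot> y) = N +> r \<odot> x"
    by blast
  then show ?thesis
    using x by (simp add: archimedeanization_def arch_quotient_map_def)
qed

text \<open>The positive cone of the quotient is the image of \<open>D\<close>; its preimage is \<open>D\<close> again.\<close>

lemma quotient_map_in_cone_iff:
  assumes x: "x \<in> carrier V"
  shows "q x \<in> pos_cone A \<longleftrightarrow> x \<in> D"
proof
  assume "q x \<in> pos_cone A"
  then obtain v where v: "v \<in> D" "q x = q v"
    by (auto simp: arch_cone)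
  then have "x \<ominus> v \<in> D"
    using x by (simp add: quotient_map_eq_iff arch_D_carrier arch_N_iff)
  then have "(x \<ominus> v) \<oplus> v \<in> D"
    using v by (intro arch_D_add)
  moreover have "(x \<ominus> v) \<oplus> v = x"
    using x v by (simp add: a_minus_def arch_D_carrier M.a_assoc M.l_neg)
  ultimately show "x \<in> D"
    by simp
qed (simp add: arch_cone)

lemma arch_module: "module real_ring A"
proof (rule moduleI)
  show "cring real_ring"
    by (rule R.cring_axioms)
  show "abelian_group A"
  proof (rule abelian_groupI)
    show "\<exists>y\<in>carrier A. y \<oplus>\<^bsub>A\<^esub> x = \<zero>\<^bsub>A\<^esub>" if x: "x \<in> carrier A" for x
    proof -
      obtain v where v: "v \<in> carrier V" "x = q v"
        using x by (auto simp: arch_carrier)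
      then have "q (\<ominus> v) \<oplus>\<^bsub>A\<^esub> x = \<zero>\<^bsub>A\<^esub>"
        by (simp add: arch_add arch_zero M.l_neg)
      with v show ?thesis
        by (intro bexI[of _ "q (\<ominus> v)"]) simp_all
    qed
  qed (auto simp: arch_carrier arch_add arch_zero M.add.m_ac)
qed (auto simp: real_ring_def arch_carrier arch_add arch_smult smult_add_left smult_add_right smult_mult)

lemma arch_minus:
  assumes "x \<in> carrier V"
  shows "\<ominus>\<^bsub>A\<^esub> q x = q (\<ominus> x)"
proof -
  interpret A: module real_ring A by (rule arch_module)
  have "q (\<ominus> x) \<oplus>\<^bsub>A\<^esub> q x = \<zero>\<^bsub>A\<^esub>"
    using assms by (simp add: arch_add arch_zero M.l_neg)
  then show ?thesis
    using assms by (intro A.M.minus_equality) simp_all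
qed

lemma arch_ordered_vector_space: "ordered_vector_space A"
proof (intro ordered_vector_space.intro arch_module ordered_vector_space_axioms.intro)
  show "pos_cone A \<subseteq> carrier A"
    by (auto simp: arch_cone arch_D_carrier)
  show "pos_cone A \<noteq> {}"
    using zero_in_cone cone_subset_arch_D by (auto simp: arch_cone)
  show "x \<oplus>\<^bsub>A\<^esub> y \<in> pos_cone A" if "x \<in> pos_cone A" "y \<in> pos_cone A" for x y
    using that by (auto simp: arch_cone arch_add arch_D_carrier arch_D_add)
  show "r \<odot>\<^bsub>A\<^esub> x \<in> pos_cone A" if "(r::real) \<ge> 0" "x \<in> pos_cone A" for r x
    using that by (auto simp: arch_cone arch_smult arch_D_carrier arch_D_smult)
  show "pos_cone A \<inter> (\<lambda>x. \<ominus>\<^bsub>A\<^esub> x) ` pos_cone A = {\<zero>\<^bsub>A\<^esub>}"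
  proof
    show "pos_cone A \<inter> (\<lambda>x. \<ominus>\<^bsub>A\<^esub> x) ` pos_cone A \<subseteq> {\<zero>\<^bsub>A\<^esub>}"
    proof
      fix z assume "z \<in> pos_cone A \<inter> (\<lambda>x. \<ominus>\<^bsub>A\<^esub> x) ` pos_cone A"
      then obtain v where "v \<in> D" "z = \<ominus>\<^bsub>A\<^esub> q v" "z \<in> pos_cone A"
        unfolding arch_cone by blast
      then have v: "v \<in> D" "z = q (\<ominus> v)" "q (\<ominus> v) \<in> pos_cone A"
        by (simp_all add: arch_minus arch_D_carrier)
      then have "\<ominus> v \<in> N"
        using quotient_map_in_cone_iff[of "\<ominus> v"] by (simp add: arch_N_iff arch_D_carrier)
      then have "q (\<ominus> v) = q \<zero>"
        using v by (simp add: quotient_map_eq_iff arch_D_carrier)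
      with v show "z \<in> {\<zero>\<^bsub>A\<^esub>}"
        by (simp add: arch_zero)
    qed
    have D0: "\<zero> \<in> D"
      using zero_in_cone cone_subset_arch_D by blast
    have "\<ominus>\<^bsub>A\<^esub> \<zero>\<^bsub>A\<^esub> = \<zero>\<^bsub>A\<^esub>"
      by (simp add: arch_zero arch_minus)
    then show "{\<zero>\<^bsub>A\<^esub>} \<subseteq> pos_cone A \<inter> (\<lambda>x. \<ominus>\<^bsub>A\<^esub> x) ` pos_cone A"
      using D0 by (force simp: arch_cone arch_zero)
  qed
qed

lemma quotient_map_unit: "q e = arch_unit V e"
  by (simp add: arch_quotient_map_def arch_unit_def)

lemma arch_vec_ge:
  assumes "x \<in> carrier V" "y \<in> carrier V"
  shows "vec_ge A (q x) (q y) \<longleftrightarrow> x \<ominus> y \<in> D"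
proof -
  have "q x \<ominus>\<^bsub>A\<^esub> q y = q (x \<ominus> y)"
    using assms by (simp add: a_minus_def arch_minus arch_add)
  then show ?thesis
    using assms by (simp add: vec_ge_def quotient_map_in_cone_iff)
qed

lemma arch_archimedean_order_unit: "archimedean_order_unit A (arch_unit V e)"
  unfolding archimedean_order_unit_def order_unit_def quotient_map_unit[symmetric]
proof (intro conjI ballI impI)
  show "q e \<in> carrier A"
    by simp
  fix x assume "x \<in> carrier A"
  then obtain v where v: "v \<in> carrier V" "x = q v"
    by (auto simp: arch_carrier)
  show "\<exists>r>0. vec_ge A (r \<odot>\<^bsub>A\<^esub> q e) x"
  proof -
    obtain r :: real where "r > 0" "r \<odot> e \<ominus> v \<in> pos_cone V"
      using order_unit v by (auto simp: order_unit_def vec_ge_def)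
    then show ?thesis
      using v cone_subset_arch_D by (auto simp: arch_smult arch_vec_ge)
  qed
  assume *: "\<forall>r>0. vec_ge A (r \<odot>\<^bsub>A\<^esub> q e \<oplus>\<^bsub>A\<^esub> x) \<zero>\<^bsub>A\<^esub>"
  have "r \<odot> e \<oplus> v \<in> D" if "r > 0" for r :: real
    using * that v by (simp add: arch_smult arch_add arch_zero arch_vec_ge)
  then show "x \<in> pos_cone A"
    using v arch_D_archimedean by (simp add: quotient_map_in_cone_iff)
qed

section \<open>The universal property\<close>

lemma quotient_map_positive: "q \<in> positive_linear_maps V A"
proof -
  have "q \<in> carrier V \<rightarrow>\<^sub>E carrier A"
    by (rule PiE_I) (simp, simp add: arch_quotient_map_def)
  then show ?thesis
    using cone_subset_arch_D
    by (auto simp: positive_linear_maps_def linear_maps_def arch_add arch_smult arch_cone)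
qed

text \<open>
  This is the only place where the Archimedean property of the target enters: \<open>r e' + \<phi>(v) \<ge> 0\<close>
  for all \<open>r > 0\<close>, hence \<open>\<phi>(v) \<ge> 0\<close>.
\<close>

lemma unital_positive_map_arch_D:
  assumes W: "ordered_vector_space W" "archimedean_order_unit W (\<phi> e)"
    and \<phi>: "\<phi> \<in> positive_linear_maps V W" and v: "v \<in> D"
  shows "\<phi> v \<in> pos_cone W"
proof -
  interpret W: ordered_vector_space W by fact
  have vc: "v \<in> carrier V"
    using v by (rule arch_D_carrier)
  have fv: "\<phi> v \<in> carrier W" and fe: "\<phi> e \<in> carrier W"
    using \<phi> vc unit_carrier by (auto simp: positive_linear_maps_def linear_maps_def)
  have "vec_ge W (r \<odot>\<^bsub>W\<^esub> \<phi> e \<oplus>\<^bsub>W\<^esub> \<phi> v) \<zero>\<^bsub>W\<^esub>" if "r > 0" for r :: real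
  proof -
    have "\<phi> (r \<odot> e \<oplus> v) = r \<odot>\<^bsub>W\<^esub> \<phi> e \<oplus>\<^bsub>W\<^esub> \<phi> v"
      using \<phi> vc by (auto simp: positive_linear_maps_def linear_maps_def)
    moreover have "\<phi> (r \<odot> e \<oplus> v) \<in> pos_cone W"
      using \<phi> v that by (auto simp: positive_linear_maps_def arch_D_def)
    ultimately show ?thesis
      using fv fe by (simp add: vec_ge_def)
  qed
  then show ?thesis
    using W(2) fv by (simp add: archimedean_order_unit_def)
qed

lemma unital_positive_map_factors:
  assumes W: "ordered_vector_space W" "archimedean_order_unit W (\<phi> e)"
    and \<phi>: "\<phi> \<in> positive_linear_maps V W"
  shows "\<exists>\<phi>'\<in>positive_linear_maps A W. \<phi> = compose (carrier V) \<phi>' q"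
proof -
  interpret W: ordered_vector_space W by fact
  have lin: "\<phi> \<in> linear_maps V W"
    using \<phi> by (simp add: positive_linear_maps_def)
  have carr: "\<phi> x \<in> carrier W" if "x \<in> carrier V" for x
    using lin that by (auto simp: linear_maps_def)
  note minus = linear_maps_minus[OF ordered_vector_space_axioms W(1) lin]
  have kernel: "\<phi> x = \<phi> y" if x: "x \<in> carrier V" and y: "y \<in> carrier V" and "q x = q y" for x y
  proof -
    have N: "x \<ominus> y \<in> N"
      using that by (simp add: quotient_map_eq_iff)
    then have "\<phi> (x \<ominus> y) \<in> pos_cone W" "\<phi> (\<ominus> (x \<ominus> y)) \<in> pos_cone W"
      using unital_positive_map_arch_D[OF W \<phi>] by (auto simp: arch_N_iff)
    then have "\<phi> (x \<ominus> y) = \<zero>\<^bsub>W\<^esub>"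
      using x y minus[of "x \<ominus> y"] by (intro W.cone_antisym) simp_all
    moreover have "\<phi> (x \<ominus> y) = \<phi> x \<oplus>\<^bsub>W\<^esub> \<ominus>\<^bsub>W\<^esub> \<phi> y"
      using x y lin minus[of y] by (simp add: a_minus_def linear_maps_def)
    ultimately show ?thesis
      using W.M.minus_equality[of "\<phi> x" "\<ominus>\<^bsub>W\<^esub> \<phi> y"] carr[OF x] carr[OF y] by simp
  qed
  \<comment> \<open>The factor evaluates \<open>\<phi>\<close> at an arbitrary representative of the coset.\<close>
  define \<phi>' where "\<phi>' = (\<lambda>X\<in>carrier A. \<phi> (inv_into (carrier V) q X))"
  have \<phi>'_q: "\<phi>' (q x) = \<phi> x" if "x \<in> carrier V" for x
    using that kernel[OF inv_into_into[of "q x" q "carrier V"] that f_inv_into_f[of "q x" q "carrier V"]]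
    by (simp add: \<phi>'_def arch_carrier)
  have "\<phi>' \<in> carrier A \<rightarrow>\<^sub>E carrier W"
  proof (rule PiE_I)
    show "\<phi>' X \<in> carrier W" if "X \<in> carrier A" for X
      using that \<phi>'_q carr by (auto simp: arch_carrier)
  qed (simp add: \<phi>'_def)
  then have "\<phi>' \<in> linear_maps A W"
    using lin by (auto simp: linear_maps_def arch_carrier arch_add arch_smult \<phi>'_q)
  moreover have "\<phi>' ` pos_cone A \<subseteq> pos_cone W"
    using unital_positive_map_arch_D[OF W \<phi>] by (auto simp: arch_cone \<phi>'_q arch_D_carrier)
  moreover have "\<phi> = compose (carrier V) \<phi>' q"
  proof (rule extensionalityI[of _ "carrier V"])
    show "\<phi> \<in> extensional (carrier V)"
      using lin by (auto simp: linear_maps_def PiE_def)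
  qed (simp_all add: compose_eq \<phi>'_q)
  ultimately show ?thesis
    by (auto simp: positive_linear_maps_def)
qed

end

text \<open>
  Linear maps out of a space are determined by their composition with a surjection onto that space,
  since they are \<open>undefined\<close> outside the carrier.
\<close>

lemma linear_maps_cancel_surjection:
  assumes "f \<in> linear_maps B W" "g \<in> linear_maps B W"
    and "p ` S = carrier B" "compose S f p = compose S g p"
  shows "f = g"
proof (rule extensionalityI[of _ "carrier B"])
  show "f \<in> extensional (carrier B)" "g \<in> extensional (carrier B)"
    using assms(1,2) by (auto simp: linear_maps_def PiE_def)
  show "f x = g x" if "x \<in> carrier B" for x
    using that assms(3) fun_cong[OF assms(4)] by (metis compose_eq imageE)
qed

lemma (in order_unit_space) arch_universal: "arch_universal TYPE('w) V e A q"
  unfolding arch_universal_def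
proof (intro allI impI, elim conjE)
  fix W :: "'w ordered_module" and e' \<phi>
  assume W: "ordered_vector_space W" "archimedean_order_unit W e'"
    and \<phi>: "\<phi> \<in> positive_linear_maps V W" "\<phi> e = e'"
  then obtain \<phi>' where \<phi>': "\<phi>' \<in> positive_linear_maps A W" "\<phi> = compose (carrier V) \<phi>' q"
    using unital_positive_map_factors[of W \<phi>] by blast
  show "\<exists>!\<phi>'. \<phi>' \<in> positive_linear_maps A W \<and> \<phi> = compose (carrier V) \<phi>' q"
  proof (rule ex1I[of _ \<phi>'])
    show "\<psi> = \<phi>'" if "\<psi> \<in> positive_linear_maps A W \<and> \<phi> = compose (carrier V) \<psi> q" for \<psi>
      using that \<phi>' by (intro linear_maps_cancel_surjection[of \<psi> A W \<phi>' q "carrier V"])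
        (auto simp: positive_linear_maps_def arch_carrier)
  qed (use \<phi>' in simp)
qed

section \<open>Uniqueness of the Archimedeanization\<close>

text \<open>
  Two positive linear maps that intertwine surjections \<open>p\<close> and \<open>p'\<close> in both directions are
  inverse to each other; no structure on the common domain \<open>S\<close> is needed.
\<close>

lemma order_isomorphism_of_mutual_factorizations:
  assumes f: "f \<in> positive_linear_maps B C" and g: "g \<in> positive_linear_maps C B"
    and p: "p ` S = carrier B" and p': "p' ` S = carrier C"
    and fp: "p' = compose S f p" and gp: "p = compose S g p'"
  shows "f \<in> order_isomorphisms B C"
proof -
  have f_p: "f (p s) = p' s" and g_p': "g (p' s) = p s" if "s \<in> S" for s
    using fun_cong[OF fp, of s] fun_cong[OF gp, of s] that by (simp_all add: compose_eq)
  have gf: "g (f x) = x" if "x \<in> carrier B" for x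
    using that f_p g_p' unfolding p[symmetric] by auto
  have fg: "f (g y) = y" if "y \<in> carrier C" for y
    using that f_p g_p' unfolding p'[symmetric] by auto
  have "bij_betw f (carrier B) (carrier C)"
    using f g by (intro bij_betw_byWitness[of _ g])
      (auto simp: gf fg positive_linear_maps_def linear_maps_def)
  moreover have "v \<in> pos_cone B \<longleftrightarrow> f v \<in> pos_cone C" if "v \<in> carrier B" for v
    using f g gf[OF that] by (auto simp: positive_linear_maps_def dest!: imageI[of "f v" _ g])
  ultimately show ?thesis
    using f by (simp add: order_isomorphisms_def positive_linear_maps_def)
qed

theorem theorem2p38:
  fixes V :: "'v ordered_module" and e :: 'v
  assumes "ordered_vector_space V" and "order_unit V e"
  shows "\<exists>q. q = arch_quotient_map V e \<and>
    q \<in> positive_linear_maps V (archimedeanization V e) \<and>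
    q e = arch_unit V e \<and>
    q ` carrier V = carrier (archimedeanization V e) \<and>
    arch_universal TYPE('w) V e (archimedeanization V e) q \<and>
    (\<forall>(V' :: 'a ordered_module) u q'.
       ordered_vector_space V' \<and> archimedean_order_unit V' u \<and>
       q' \<in> positive_linear_maps V V' \<and> q' e = u \<and> q' ` carrier V = carrier V' \<and>
       arch_universal TYPE('v set) V e V' q' \<longrightarrow>
       (\<exists>\<psi>. \<psi> \<in> order_isomorphisms (archimedeanization V e) V' \<and>
            \<psi> (arch_unit V e) = u \<and>
            compose (carrier V) \<psi> q = q'))"
proof -
  interpret order_unit_space V e
    using assms by (simp add: order_unit_space_def order_unit_space_axioms_def)
  have unique: "\<exists>\<psi>. \<psi> \<in> order_isomorphisms A V' \<and> \<psi> (arch_unit V e) = u \<and> compose (carrier V) \<psi> q = q'"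
    if V': "ordered_vector_space V'" "archimedean_order_unit V' u"
      and q': "q' \<in> positive_linear_maps V V'" "q' e = u" "q' ` carrier V = carrier V'"
      and univ: "arch_universal TYPE('v set) V e V' q'"
    for V' :: "'a ordered_module" and u q'
  proof -
    obtain f where f: "f \<in> positive_linear_maps A V'" "q' = compose (carrier V) f q"
      using unital_positive_map_factors[of V' q'] V' q' by blast
    \<comment> \<open>The universal property of \<open>q'\<close> is applied to \<open>q\<close> itself.\<close>
    obtain g where g: "g \<in> positive_linear_maps V' A" "q = compose (carrier V) g q'"
      using univ arch_ordered_vector_space arch_archimedean_order_unit quotient_map_positive
        quotient_map_unit unfolding arch_universal_def by blast
    have "f \<in> order_isomorphisms A V'"
      using f g q' arch_carrier by (intro order_isomorphism_of_mutual_factorizations) auto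
    moreover have "f (arch_unit V e) = u"
      using q'(2) fun_cong[OF f(2), of e] by (simp add: compose_eq quotient_map_unit)
    ultimately show ?thesis
      using f(2) by blast
  qed
  show ?thesis
    using quotient_map_positive quotient_map_unit arch_carrier arch_universal unique
    by (intro exI[of _ q]) auto
qed

end
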